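(* Every non-null nilpotent odd-symplectic Lie superalgebra is obtained from $\{0\}$ by a sequence of double extensions by the one-dimensional Lie algebra and/or generalized double extensions by the one-dimensional Lie superalgebra with null even part.
   Context: All Lie superalgebras are finite dimensional over an algebraically closed field $\mathbb K$ of characteristic zero; $|x|\in\mathbb Z_2$ is the degree of a homogeneous $X$. "Non-null" means nonzero. A bilinear form $\omega$ on $\mathfrak g$ is odd if $\omega(\mathfrak g_\alpha,\mathfrak g_\alpha)=\{0\}$ for all $\alpha\in\mathbb Z_2$, and skew-supersymmetric if $\omega(X,Y)=-(-1)^{|x||y|}\omega(Y,X)$. An odd-symplectic form is an odd, skew-supersymmetric, non-degenerate bilinear form with $(-1)^{|z||x|}\omega(X,[Y,Z])+(-1)^{|x||y|}\omega(Y,[Z,X])+(-1)^{|y||z|}\omega(Z,[X,Y])=0$ for homogeneous $X,Y,Z$; $(\mathfrak g,\omega)$ is then an odd-symplectic Lie superalgebra. A superderivation $D$ of degree $d$ is a linear map with $D(\mathfrak g_\alpha)\subseteq\mathfrak g_{\alpha+d}$ and $D[X,Y]=[D(X),Y]+(-1)^{d|x|}[X,D(Y)]$. For such $D$, $D^*$ denotes the map with $\omega(D^*(X),Y)=\omega(X,D(Y))$. Let $(\mathfrak h,\omega_{\mathfrak h})$ be an odd-symplectic Lie superalgebra, $D$ a superderivation of $\mathfrak h$ of degree $|e|\in\mathbb Z_2$, and $\mathfrak t=\mathbb Ke^*\oplus\mathfrak h\oplus\mathbb Ke$ with $e$ of degree $|e|$ and $e^*$ of degree $|e|+\bar1$.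 Put $\gamma(X,Y)=-[\omega_{\mathfrak h}(D(X),Y)+(-1)^{|e||x|}\omega_{\mathfrak h}(X,D(Y))]$. Let $\Omega$ be the skew-supersymmetric form on $\mathfrak t$ with $\Omega|_{\mathfrak h\times\mathfrak h}=\omega_{\mathfrak h}$, $\Omega(e^*,e)=1$ and all other pairings zero (except $\Omega(e,e^* )$, given by skew-supersymmetry). - Double extension of $(\mathfrak h,\omega_{\mathfrak h})$ by the one-dimensional Lie algebra, by means of $(D,b_0)$ (case $|e|=\bar0$): $b_0\in\mathfrak h_{\bar0}$ satisfies $\omega_{\mathfrak h}\bigl([D^*(D+D^* )+(D+D^* )D](X),Y\bigr)=\omega_{\mathfrak h}(b_0,[X,Y]_{\mathfrak h})$ for all $X,Y\in\mathfrak h$; it is $(\mathfrak t,\Omega)$ with $e^*$ central, $[e,e]=0$, $[e,X]=D(X)-\omega_{\mathfrak h}(b_0,X)e^*$, $[X,Y]=[X,Y]_{\mathfrak h}+\gamma(X,Y)e^*$. - Generalized double extension of $(\mathfrak h,\omega_{\mathfrak h})$ by the one-dimensional Lie superalgebra with null even part, by means of $(D,x_0)$ (case $|e|=\bar1$): $x_0\in\mathfrak h_{\bar0}$ satisfies $D^2=\frac12[x_0,\cdot]_{\mathfrak h}$ and $D(x_0)=0$; it is $(\mathfrak t,\Omega)$ with $e^*$ central, $[e,e]=x_0$, $[e,X]=D(X)-\frac12\omega_{\mathfrak h}(x_0,X)e^*$, $[X,Y]=[X,Y]_{\mathfrak h}+\gamma(X,Y)e^*$. Both are odd-symplectic Lie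 superalgebras; "is obtained" is understood up to isomorphism of Lie superalgebras preserving the symplectic forms. *)

theory Defs
  imports
    "HOL-Computational_Algebra.Polynomial"
    "HOL-Library.Z2"
    "HOL-Library.Product_Plus"
begin

section \<open>Lie superalgebras\<close>

text \<open>
  Degrees are elements of the two-element field \<^typ>\<open>bit\<close>. The homogeneous parts of a superalgebra
  are subspaces of an ambient vector space, so that all the algebras of an iterated construction
  can live on one type; the values of the bracket outside the sum of the homogeneous parts are
  irrelevant.
\<close>

record ('k, 'v) superalg =
  scl :: "'k \<Rightarrow> 'v \<Rightarrow> 'v"
  hom :: "bit \<Rightarrow> 'v set"
  brk :: "'v \<Rightarrow> 'v \<Rightarrow> 'v"

definition sspace :: "('k, 'v::ab_group_add) superalg \<Rightarrow> 'v set" where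
  "sspace G = {x + y |x y. x \<in> hom G 0 \<and> y \<in> hom G 1}"

text \<open>\<open>sgn2 a\<close> is $(-1)^a$.\<close>

definition sgn2 :: "bit \<Rightarrow> 'k::field" where
  "sgn2 a = (if a = 1 then - 1 else 1)"

definition linear_between ::
    "'v::ab_group_add set \<Rightarrow> ('k \<Rightarrow> 'v \<Rightarrow> 'v) \<Rightarrow> ('k \<Rightarrow> 'w::ab_group_add \<Rightarrow> 'w) \<Rightarrow> ('v \<Rightarrow> 'w) \<Rightarrow> bool" where
  "linear_between V s t f \<longleftrightarrow>
     (\<forall>x\<in>V. \<forall>y\<in>V. f (x + y) = f x + f y) \<and> (\<forall>c. \<forall>x\<in>V. f (s c x) = t c (f x))"

definition bilinear_between ::
    "'v::ab_group_add set \<Rightarrow> ('k \<Rightarrow> 'v \<Rightarrow> 'v) \<Rightarrow> ('k \<Rightarrow> 'w::ab_group_add \<Rightarrow> 'w) \<Rightarrow> ('v \<Rightarrow> 'v \<Rightarrow> 'w) \<Rightarrow> bool" where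
  "bilinear_between V s t b \<longleftrightarrow>
     (\<forall>x\<in>V. linear_between V s t (b x)) \<and> (\<forall>y\<in>V. linear_between V s t (\<lambda>x. b x y))"

definition super_vector_space :: "('k::field, 'v::ab_group_add) superalg \<Rightarrow> bool" where
  "super_vector_space G \<longleftrightarrow>
     vector_space (scl G) \<and>
     (\<forall>a. module.subspace (scl G) (hom G a)) \<and>
     hom G 0 \<inter> hom G 1 = {0} \<and>
     (\<exists>B. finite B \<and> module.span (scl G) B = sspace G)"

definition lie_superalgebra :: "('k::field, 'v::ab_group_add) superalg \<Rightarrow> bool" where
  "lie_superalgebra G \<longleftrightarrow>
     super_vector_space G \<and>
     bilinear_between (sspace G) (scl G) (scl G) (brk G) \<and>
     (\<forall>a b. \<forall>x\<in>hom G a. \<forall>y\<in>hom G b. brk G x y \<in> hom G (a + b)) \<and>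
     (\<forall>a b. \<forall>x\<in>hom G a. \<forall>y\<in>hom G b.
        brk G x y = scl G (- sgn2 (a * b)) (brk G y x)) \<and>
     (\<forall>a b c. \<forall>x\<in>hom G a. \<forall>y\<in>hom G b. \<forall>z\<in>hom G c.
        scl G (sgn2 (c * a)) (brk G x (brk G y z))
        + scl G (sgn2 (a * b)) (brk G y (brk G z x))
        + scl G (sgn2 (b * c)) (brk G z (brk G x y)) = 0)"

fun lower_central :: "('k::field, 'v::ab_group_add) superalg \<Rightarrow> nat \<Rightarrow> 'v set" where
  "lower_central G 0 = sspace G"
| "lower_central G (Suc n) =
     module.span (scl G) {brk G x y |x y. x \<in> sspace G \<and> y \<in> lower_central G n}"

definition nilpotent :: "('k::field, 'v::ab_group_add) superalg \<Rightarrow> bool" where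
  "nilpotent G \<longleftrightarrow> (\<exists>n. lower_central G n = {0})"

definition superderivation ::
    "('k::field, 'v::ab_group_add) superalg \<Rightarrow> bit \<Rightarrow> ('v \<Rightarrow> 'v) \<Rightarrow> bool" where
  "superderivation G d D \<longleftrightarrow>
     linear_between (sspace G) (scl G) (scl G) D \<and>
     (\<forall>a. \<forall>x\<in>hom G a. D x \<in> hom G (a + d)) \<and>
     (\<forall>a. \<forall>x\<in>hom G a. \<forall>y\<in>sspace G.
        D (brk G x y) = brk G (D x) y + scl G (sgn2 (d * a)) (brk G x (D y)))"

section \<open>Odd-symplectic forms\<close>

definition odd_symplectic_form ::
    "('k::field, 'v::ab_group_add) superalg \<Rightarrow> ('v \<Rightarrow> 'v \<Rightarrow> 'k) \<Rightarrow> bool" where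
  "odd_symplectic_form G \<omega> \<longleftrightarrow>
     bilinear_between (sspace G) (scl G) (*) \<omega> \<and>
     (\<forall>a. \<forall>x\<in>hom G a. \<forall>y\<in>hom G a. \<omega> x y = 0) \<and>
     (\<forall>a b. \<forall>x\<in>hom G a. \<forall>y\<in>hom G b. \<omega> x y = - sgn2 (a * b) * \<omega> y x) \<and>
     (\<forall>x\<in>sspace G. (\<forall>y\<in>sspace G. \<omega> x y = 0) \<longrightarrow> x = 0) \<and>
     (\<forall>a b c. \<forall>x\<in>hom G a. \<forall>y\<in>hom G b. \<forall>z\<in>hom G c.
        sgn2 (c * a) * \<omega> x (brk G y z)
        + sgn2 (a * b) * \<omega> y (brk G z x)
        + sgn2 (b * c) * \<omega> z (brk G x y) = 0)"

definition odd_symplectic ::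
    "('k::field, 'v::ab_group_add) superalg \<Rightarrow> ('v \<Rightarrow> 'v \<Rightarrow> 'k) \<Rightarrow> bool" where
  "odd_symplectic G \<omega> \<longleftrightarrow> lie_superalgebra G \<and> odd_symplectic_form G \<omega>"

definition symplectic_iso ::
    "('k::field, 'v::ab_group_add) superalg \<Rightarrow> ('v \<Rightarrow> 'v \<Rightarrow> 'k) \<Rightarrow>
     ('k, 'w::ab_group_add) superalg \<Rightarrow> ('w \<Rightarrow> 'w \<Rightarrow> 'k) \<Rightarrow> ('v \<Rightarrow> 'w) \<Rightarrow> bool" where
  "symplectic_iso G \<omega> G' \<omega>' f \<longleftrightarrow>
     linear_between (sspace G) (scl G) (scl G') f \<and>
     bij_betw f (sspace G) (sspace G') \<and>
     (\<forall>a. f ` hom G a = hom G' a) \<and>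
     (\<forall>x\<in>sspace G. \<forall>y\<in>sspace G. f (brk G x y) = brk G' (f x) (f y)) \<and>
     (\<forall>x\<in>sspace G. \<forall>y\<in>sspace G. \<omega>' (f x) (f y) = \<omega> x y)"

text \<open>The map $D^*$; it is unique on \<open>sspace G\<close> because \<open>\<omega>\<close> is non-degenerate.\<close>

definition adjoint_map ::
    "('k::field, 'v::ab_group_add) superalg \<Rightarrow> ('v \<Rightarrow> 'v \<Rightarrow> 'k) \<Rightarrow> ('v \<Rightarrow> 'v) \<Rightarrow> 'v \<Rightarrow> 'v" where
  "adjoint_map G \<omega> D x = (THE z. z \<in> sspace G \<and> (\<forall>y\<in>sspace G. \<omega> z y = \<omega> x (D y)))"

section \<open>Double extensions\<close>

definition hcomp :: "('k::field, 'v::ab_group_add) superalg \<Rightarrow> bit \<Rightarrow> 'v \<Rightarrow> 'v" where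
  "hcomp G a x = (THE y. y \<in> hom G a \<and> x - y \<in> hom G (a + 1))"

text \<open>The linear map \<open>twist G d\<close> sends a homogeneous $X$ to $(-1)^{d|X|}X$. It extends formulas
  containing the sign $(-1)^{d|X|}$ to non-homogeneous elements.\<close>

definition twist :: "('k::field, 'v::ab_group_add) superalg \<Rightarrow> bit \<Rightarrow> 'v \<Rightarrow> 'v" where
  "twist G d x = hcomp G 0 x + scl G (sgn2 d) (hcomp G 1 x)"

definition ext_cocycle ::
    "('k::field, 'v::ab_group_add) superalg \<Rightarrow> ('v \<Rightarrow> 'v \<Rightarrow> 'k) \<Rightarrow> bit \<Rightarrow> ('v \<Rightarrow> 'v) \<Rightarrow> 'v \<Rightarrow> 'v \<Rightarrow> 'k" where
  "ext_cocycle H \<omega> d D x y = - (\<omega> (D x) y + \<omega> (twist H d x) (D y))"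

text \<open>
  The triple \<open>(r, X, a)\<close> stands for $r e^* + X + a e$, where $e$ has degree \<open>d\<close> and $e^*$ has degree
  \<open>d + 1\<close>. The bracket is the bilinear one with $e^*$ central, $[e,e] = z$,
  $[e,X] = D(X) - \beta(X) e^*$, $[X,e] = -(-1)^{d|X|}[e,X]$ and $[X,Y] = [X,Y]_H + \gamma(X,Y) e^*$,
  where $\gamma$ is \<open>ext_cocycle H \<omega> d D\<close>.
\<close>

definition ext_alg ::
    "('k::field, 'v::ab_group_add) superalg \<Rightarrow> ('v \<Rightarrow> 'v \<Rightarrow> 'k) \<Rightarrow> bit \<Rightarrow> ('v \<Rightarrow> 'v) \<Rightarrow> 'v \<Rightarrow> ('v \<Rightarrow> 'k) \<Rightarrow>
     ('k, 'k \<times> 'v \<times> 'k) superalg" where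
  "ext_alg H \<omega> d D z \<beta> =
     \<lparr>scl = (\<lambda>c (r, x, a). (c * r, scl H c x, c * a)),
      hom = (\<lambda>i. {(r, x, a). x \<in> hom H i \<and> (i \<noteq> d + 1 \<longrightarrow> r = 0) \<and> (i \<noteq> d \<longrightarrow> a = 0)}),
      brk = (\<lambda>(r, x, a) (s, y, b).
        (ext_cocycle H \<omega> d D x y - a * \<beta> y + b * \<beta> (twist H d x),
         brk H x y + scl H a (D y) - scl H b (D (twist H d x)) + scl H (a * b) z,
         0))\<rparr>"

text \<open>As one of $|e|$, $|e^*|$ is zero, skew-supersymmetry gives $\Omega(e,e^*) = -\Omega(e^*,e) = -1$.\<close>

definition ext_form :: "('v \<Rightarrow> 'v \<Rightarrow> 'k::field) \<Rightarrow> 'k \<times> 'v \<times> 'k \<Rightarrow> 'k \<times> 'v \<times> 'k \<Rightarrow> 'k" where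
  "ext_form \<omega> = (\<lambda>(r, x, a) (s, y, b). \<omega> x y + r * b - a * s)"

definition double_ext_datum ::
    "('k::field, 'v::ab_group_add) superalg \<Rightarrow> ('v \<Rightarrow> 'v \<Rightarrow> 'k) \<Rightarrow> ('v \<Rightarrow> 'v) \<Rightarrow> 'v \<Rightarrow> bool" where
  "double_ext_datum H \<omega> D b\<^sub>0 \<longleftrightarrow>
     superderivation H 0 D \<and> b\<^sub>0 \<in> hom H 0 \<and>
     (let D' = adjoint_map H \<omega> D; S = (\<lambda>x. D x + D' x) in
        \<forall>x\<in>sspace H. \<forall>y\<in>sspace H. \<omega> (D' (S x) + S (D x)) y = \<omega> b\<^sub>0 (brk H x y))"

definition double_ext ::
    "('k::field, 'v::ab_group_add) superalg \<Rightarrow> ('v \<Rightarrow> 'v \<Rightarrow> 'k) \<Rightarrow> ('v \<Rightarrow> 'v) \<Rightarrow> 'v \<Rightarrow>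
     ('k, 'k \<times> 'v \<times> 'k) superalg" where
  "double_ext H \<omega> D b\<^sub>0 = ext_alg H \<omega> 0 D 0 (\<lambda>x. \<omega> b\<^sub>0 x)"

definition gen_double_ext_datum ::
    "('k::field, 'v::ab_group_add) superalg \<Rightarrow> ('v \<Rightarrow> 'v) \<Rightarrow> 'v \<Rightarrow> bool" where
  "gen_double_ext_datum H D x\<^sub>0 \<longleftrightarrow>
     superderivation H 1 D \<and> x\<^sub>0 \<in> hom H 0 \<and>
     (\<forall>x\<in>sspace H. D (D x) = scl H (1 / 2) (brk H x\<^sub>0 x)) \<and> D x\<^sub>0 = 0"

definition gen_double_ext ::
    "('k::field, 'v::ab_group_add) superalg \<Rightarrow> ('v \<Rightarrow> 'v \<Rightarrow> 'k) \<Rightarrow> ('v \<Rightarrow> 'v) \<Rightarrow> 'v \<Rightarrow>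
     ('k, 'k \<times> 'v \<times> 'k) superalg" where
  "gen_double_ext H \<omega> D x\<^sub>0 = ext_alg H \<omega> 1 D x\<^sub>0 (\<lambda>x. 1 / 2 * \<omega> x\<^sub>0 x)"

definition is_double_ext_of ::
    "('k::field, 'v::ab_group_add) superalg \<Rightarrow> ('v \<Rightarrow> 'v \<Rightarrow> 'k) \<Rightarrow>
     ('k, 'w::ab_group_add) superalg \<Rightarrow> ('w \<Rightarrow> 'w \<Rightarrow> 'k) \<Rightarrow> bool" where
  "is_double_ext_of G \<omega>G H \<omega> \<longleftrightarrow>
     odd_symplectic G \<omega>G \<and> odd_symplectic H \<omega> \<and>
     (\<exists>D b\<^sub>0 f. double_ext_datum H \<omega> D b\<^sub>0 \<and>
        symplectic_iso (double_ext H \<omega> D b\<^sub>0) (ext_form \<omega>) G \<omega>G f)"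

definition is_gen_double_ext_of ::
    "('k::field, 'v::ab_group_add) superalg \<Rightarrow> ('v \<Rightarrow> 'v \<Rightarrow> 'k) \<Rightarrow>
     ('k, 'w::ab_group_add) superalg \<Rightarrow> ('w \<Rightarrow> 'w \<Rightarrow> 'k) \<Rightarrow> bool" where
  "is_gen_double_ext_of G \<omega>G H \<omega> \<longleftrightarrow>
     odd_symplectic G \<omega>G \<and> odd_symplectic H \<omega> \<and>
     (\<exists>D x\<^sub>0 f. gen_double_ext_datum H D x\<^sub>0 \<and>
        symplectic_iso (gen_double_ext H \<omega> D x\<^sub>0) (ext_form \<omega>) G \<omega>G f)"

text \<open>
  All members of a sequence have their homogeneous parts in the ambient type \<open>'v\<close> of the last one.
  This is no restriction: an extension has larger dimension than the algebra it extends, so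
  each member is isomorphic to one on a subspace of the last.
\<close>

inductive obtained_from_zero ::
    "('k::field, 'v::ab_group_add) superalg \<Rightarrow> ('v \<Rightarrow> 'v \<Rightarrow> 'k) \<Rightarrow> bool" where
  zero: "odd_symplectic G \<omega> \<Longrightarrow> sspace G = {0} \<Longrightarrow> obtained_from_zero G \<omega>"
| double: "obtained_from_zero H \<omega> \<Longrightarrow> is_double_ext_of G \<omega>G H \<omega> \<Longrightarrow> obtained_from_zero G \<omega>G"
| gen_double:
    "obtained_from_zero H \<omega> \<Longrightarrow> is_gen_double_ext_of G \<omega>G H \<omega> \<Longrightarrow> obtained_from_zero G \<omega>G"

end

theory Submission
  imports Defs
begin

text \<open>
  Let $\mathfrak g$ be a non-zero nilpotent odd-symplectic Lie superalgebra. The last non-zero term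
  of its lower central series is central, and the homogeneous components of a central element are
  again central, so there is a homogeneous central $e^* \neq 0$ (\<open>ex_homogeneous_central\<close>). As
  $\omega$ is odd and non-degenerate, some homogeneous $e$ of the opposite degree satisfies
  $\omega(e^*,e) = 1$.

  Since $e^*$ is central, closedness of $\omega$ gives $\omega(e^*,[\mathfrak g,\mathfrak g]) = 0$:
  the hyperplane $(e^*)^\perp$ is an ideal containing $e^*$, because $\omega(e^*,e^*) = 0$. The
  symplectic reduction $\mathfrak h = (e^*)^\perp/\mathbb Ke^*$ is again a nilpotent odd-symplectic
  Lie superalgebra, of dimension smaller by two. It is realised on the orthogonal complement of
  $\mathbb Ke^* \oplus \mathbb Ke$, so that $\mathfrak g = \mathbb Ke^* \oplus \mathfrak h \oplus
  \mathbb Ke$ holds inside $\mathfrak g$, and its bracket is that of $\mathfrak g$ followed by the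
  projection to $\mathfrak h$.

  The remaining structure of $\mathfrak g$ is encoded by the superderivation $D$ of $\mathfrak h$
  induced by $[e,\cdot]$, by $[e,e]$, and by the $e^*$-coefficients of brackets, which are the values
  of $-\omega(e,\cdot)$. Closedness of $\omega$ forces the coefficient of $[X,Y]$ to be
  $\gamma(X,Y)$ and that of $[e,e]$ to be $0$; with this, $\mathfrak g$ has the shape
  of an extension of $\mathfrak h$ (\<open>symplectic_iso_embed\<close>). The conditions on the data are the
  Jacobi identities that involve $e$:

  \<^item> If $e$ is even, then $[e,e] = 0$. The functional $X \mapsto \omega(e,[e,X])$ is represented
    by some even $b_0 \in \mathfrak h$, and the $e^*$-coefficient of the Jacobi identity of $e,X,Y$ is
    the equation relating $b_0$ to $D$ and $D^*$ (\<open>double_ext_of_reduct\<close>).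
  \<^item> If $e$ is odd, put $x_0 = [e,e]$. The Jacobi identities of $e,e,X$ and of $e,e,e$ give
    $D^2 = \frac12[x_0,\cdot]$ and $D(x_0) = 0$, and closedness on $e,e,X$ gives
    $\omega(e,[e,X]) = \frac12\omega(x_0,X)$ (\<open>gen_double_ext_of_reduct\<close>).

  Induction on the dimension finishes the proof.
\<close>

section \<open>Signs and graded decompositions\<close>

lemma bit_add_self [simp]: "(a::bit) + a = 0" "a + (a + b) = b" "a + (b + a) = b" "a + b + b = a"
  by (cases a; cases b; simp)+

lemma sgn2_simps [simp]: "sgn2 0 = 1" "sgn2 1 = - 1"
  by (simp_all add: sgn2_def)

lemma sspace_cases:
  assumes "x \<in> sspace S"
  obtains u v where "u \<in> hom S 0" "v \<in> hom S 1" "x = u + v"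
  using assms unfolding sspace_def by blast

lemma twist_add:
  assumes S: "super_vector_space S" and u: "u \<in> hom S 0" and v: "v \<in> hom S 1"
  shows "twist S d (u + v) = u + scl S (sgn2 d) v"
proof -
  interpret V: vector_space "scl S" using S by (simp add: super_vector_space_def)
  have sub: "V.subspace (hom S a)" and int: "hom S 0 \<inter> hom S 1 = {0}" for a
    using S unfolding super_vector_space_def by auto
  have "hcomp S 0 (u + v) = u"
    unfolding hcomp_def
  proof (rule the_equality)
    fix y assume y: "y \<in> hom S 0 \<and> u + v - y \<in> hom S (0 + 1)"
    then have "u - y \<in> hom S 0" "u + v - y - v \<in> hom S 1"
      using V.subspace_diff[OF sub u, of y] V.subspace_diff[OF sub _ v, of "u + v - y"] by auto
    then have "u - y \<in> hom S 0 \<inter> hom S 1" by (simp add: algebra_simps)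
    then show "y = u" using int by simp
  qed (use u v in simp)
  moreover have "hcomp S 1 (u + v) = v"
    unfolding hcomp_def
  proof (rule the_equality)
    fix y assume y: "y \<in> hom S 1 \<and> u + v - y \<in> hom S (1 + 1)"
    then have "v - y \<in> hom S 1" "u + v - y - u \<in> hom S 0"
      using V.subspace_diff[OF sub v, of y] V.subspace_diff[OF sub _ u, of "u + v - y"] by auto
    then have "v - y \<in> hom S 0 \<inter> hom S 1" by (simp add: algebra_simps)
    then show "y = v" using int by simp
  qed (use u v in simp)
  ultimately show ?thesis by (simp add: twist_def)
qed

section \<open>Odd-symplectic superalgebras\<close>

locale odd_symplectic_superalgebra =
  fixes G :: "('k::field_char_0, 'v::ab_group_add) superalg" and \<omega> :: "'v \<Rightarrow> 'v \<Rightarrow> 'k"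
  assumes odd_symplectic: "odd_symplectic G \<omega>"
begin

lemma lie: "lie_superalgebra G" and form: "odd_symplectic_form G \<omega>"
  using odd_symplectic by (simp_all add: odd_symplectic_def)

lemma super: "super_vector_space G"
  using lie unfolding lie_superalgebra_def by (rule conjunct1)

lemma brk_bilinear: "bilinear_between (sspace G) (scl G) (scl G) (brk G)"
  using lie unfolding lie_superalgebra_def by (elim conjE)

lemma form_bilinear: "bilinear_between (sspace G) (scl G) (*) \<omega>"
  using form unfolding odd_symplectic_form_def by (elim conjE)

sublocale V: vector_space "scl G"
  using super by (simp add: super_vector_space_def)

lemma subspace_hom: "V.subspace (hom G a)"
  and hom_Int: "hom G 0 \<inter> hom G 1 = {0}"
  using super unfolding super_vector_space_def by auto

lemmas hom_closed =
  V.subspace_0[OF subspace_hom] V.subspace_add[OF subspace_hom] V.subspace_diff[OF subspace_hom]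
  V.subspace_scale[OF subspace_hom] V.subspace_neg[OF subspace_hom]

lemma hom_subset: "x \<in> hom G a \<Longrightarrow> x \<in> sspace G"
  unfolding sspace_def using hom_closed(1)
  by (cases a) (auto intro: exI[of _ x] exI[of _ 0])

lemma subspace_sspace: "V.subspace (sspace G)"
  unfolding sspace_def using V.subspace_sums[OF subspace_hom subspace_hom] .

lemmas sspace_closed [simp] =
  V.subspace_0[OF subspace_sspace] V.subspace_add[OF subspace_sspace]
  V.subspace_diff[OF subspace_sspace] V.subspace_scale[OF subspace_sspace]
  V.subspace_neg[OF subspace_sspace]

lemma sspace_induct [consumes 1, case_names hom add]:
  assumes "x \<in> sspace G"
    and "\<And>a x. x \<in> hom G a \<Longrightarrow> Q x"
    and "\<And>x y. x \<in> sspace G \<Longrightarrow> y \<in> sspace G \<Longrightarrow> Q x \<Longrightarrow> Q y \<Longrightarrow> Q (x + y)"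
  shows "Q x"
proof -
  obtain u v where "u \<in> hom G 0" "v \<in> hom G 1" "x = u + v"
    using assms(1) by (rule sspace_cases)
  then show ?thesis using assms(2) assms(3)[of u v] hom_subset by simp
qed

lemma hom_eq_zero: "x \<in> hom G a \<Longrightarrow> x \<in> hom G (a + 1) \<Longrightarrow> x = 0"
  using hom_Int by (cases a) auto

lemma brk_hom: "x \<in> hom G a \<Longrightarrow> y \<in> hom G b \<Longrightarrow> brk G x y \<in> hom G (a + b)"
  using lie unfolding lie_superalgebra_def by blast

lemma brk_add:
  assumes "x \<in> sspace G" "y \<in> sspace G" "w \<in> sspace G"
  shows "brk G (x + y) w = brk G x w + brk G y w" "brk G w (x + y) = brk G w x + brk G w y"
  using brk_bilinear assms unfolding bilinear_between_def linear_between_def by auto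

lemma brk_scale:
  assumes "x \<in> sspace G" "y \<in> sspace G"
  shows "brk G (scl G c x) y = scl G c (brk G x y)" "brk G x (scl G c y) = scl G c (brk G x y)"
  using brk_bilinear assms unfolding bilinear_between_def linear_between_def by auto

lemma brk_closed [simp]:
  assumes "x \<in> sspace G" "y \<in> sspace G"
  shows "brk G x y \<in> sspace G"
  using assms
proof (induction x rule: sspace_induct)
  case (hom a x)
  note x = hom(1)
  from hom(2) show ?case
  proof (induction y rule: sspace_induct)
    case (hom b y)
    then show ?case using hom_subset[OF brk_hom[OF x hom]] by simp
  qed (use hom_subset[OF x] in \<open>simp add: brk_add\<close>)
qed (simp add: brk_add)

lemma brk_minus:
  assumes "x \<in> sspace G" "y \<in> sspace G"
  shows "brk G (- x) y = - brk G x y" "brk G x (- y) = - brk G x y"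
  using brk_scale[OF assms, of "- 1"] by simp_all

lemma brk_diff:
  assumes "x \<in> sspace G" "y \<in> sspace G" "w \<in> sspace G"
  shows "brk G (x - y) w = brk G x w - brk G y w" "brk G w (x - y) = brk G w x - brk G w y"
  using brk_add[of x "- y" w] brk_minus[of y w] brk_minus[of w y] assms by simp_all

lemma brk_skew:
  "x \<in> hom G a \<Longrightarrow> y \<in> hom G b \<Longrightarrow> brk G x y = scl G (- sgn2 (a * b)) (brk G y x)"
  using lie unfolding lie_superalgebra_def by blast

lemma form_add:
  assumes "x \<in> sspace G" "y \<in> sspace G" "w \<in> sspace G"
  shows "\<omega> (x + y) w = \<omega> x w + \<omega> y w" "\<omega> w (x + y) = \<omega> w x + \<omega> w y"
  using form_bilinear assms unfolding bilinear_between_def linear_between_def by auto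

lemma form_scale:
  assumes "x \<in> sspace G" "y \<in> sspace G"
  shows "\<omega> (scl G c x) y = c * \<omega> x y" "\<omega> x (scl G c y) = c * \<omega> x y"
  using form_bilinear assms unfolding bilinear_between_def linear_between_def by auto

lemma form_minus:
  assumes "x \<in> sspace G" "y \<in> sspace G"
  shows "\<omega> (- x) y = - \<omega> x y" "\<omega> x (- y) = - \<omega> x y"
  using form_scale[OF assms, of "- 1"] by simp_all

lemma form_diff:
  assumes "x \<in> sspace G" "y \<in> sspace G" "w \<in> sspace G"
  shows "\<omega> (x - y) w = \<omega> x w - \<omega> y w" "\<omega> w (x - y) = \<omega> w x - \<omega> w y"
  using form_add[of x "- y" w] form_minus[of y w] form_minus[of w y] assms by simp_all

lemma form_zero: "x \<in> sspace G \<Longrightarrow> \<omega> 0 x = 0" "x \<in> sspace G \<Longrightarrow> \<omega> x 0 = 0"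
  using form_scale[of x x 0] by simp_all

lemmas bilin = brk_add brk_scale brk_minus brk_diff form_add form_scale form_minus form_diff

lemma form_odd: "x \<in> hom G a \<Longrightarrow> y \<in> hom G a \<Longrightarrow> \<omega> x y = 0"
  using form unfolding odd_symplectic_form_def by blast

lemma form_skew: "x \<in> hom G a \<Longrightarrow> y \<in> hom G b \<Longrightarrow> \<omega> x y = - sgn2 (a * b) * \<omega> y x"
  using form unfolding odd_symplectic_form_def by blast

lemma form_nondegenerate: "x \<in> sspace G \<Longrightarrow> (\<And>y. y \<in> sspace G \<Longrightarrow> \<omega> x y = 0) \<Longrightarrow> x = 0"
  using form unfolding odd_symplectic_form_def by blast

lemma form_eqI:
  assumes "x \<in> sspace G" "x' \<in> sspace G" "\<And>y. y \<in> sspace G \<Longrightarrow> \<omega> x y = \<omega> x' y"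
  shows "x = x'"
  using form_nondegenerate[of "x - x'"] assms by (simp add: bilin)

lemma cyclic_jacobi:
  assumes "x \<in> hom G a" "y \<in> hom G b" "w \<in> hom G c"
  shows "scl G (sgn2 (c * a)) (brk G x (brk G y w)) + scl G (sgn2 (a * b)) (brk G y (brk G w x))
    + scl G (sgn2 (b * c)) (brk G w (brk G x y)) = 0"
  using lie assms unfolding lie_superalgebra_def by blast

lemma cyclic_form:
  assumes "x \<in> hom G a" "y \<in> hom G b" "w \<in> hom G c"
  shows "sgn2 (c * a) * \<omega> x (brk G y w) + sgn2 (a * b) * \<omega> y (brk G w x)
    + sgn2 (b * c) * \<omega> w (brk G x y) = 0"
  using form assms unfolding odd_symplectic_form_def by blast

text \<open>
  The Jacobi identity in Leibniz form: $[x,\cdot]$ is a superderivation. The cyclic form is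
  multiplied by $(-1)^{|x||w|}$ and two of its brackets are reversed.
\<close>

lemma leibniz:
  assumes x: "x \<in> hom G a" and y: "y \<in> hom G b" and w: "w \<in> sspace G"
  shows "brk G x (brk G y w) = brk G (brk G x y) w + scl G (sgn2 (a * b)) (brk G y (brk G x w))"
  using w
proof (induction w rule: sspace_induct)
  case (hom c w)
  note cyclic_jacobi[OF x y hom]
  moreover have "brk G w x = scl G (- sgn2 (c * a)) (brk G x w)"
    using brk_skew[OF hom x] .
  moreover have "brk G w (brk G x y) = scl G (- sgn2 (c * (a + b))) (brk G (brk G x y) w)"
    using brk_skew[OF hom brk_hom[OF x y]] .
  ultimately show ?case using hom_subset[OF x] hom_subset[OF y] hom_subset[OF hom]
    by (cases a; cases b; cases c) (simp_all add: bilin add_eq_0_iff, simp_all add: algebra_simps)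
next
  case (add w w')
  then show ?case using hom_subset[OF x] hom_subset[OF y]
    by (simp add: bilin V.scale_right_distrib algebra_simps)
qed

text \<open>
  Closedness of \<open>\<omega>\<close>, solved for its first term in the same way, so that \<open>x\<close> acts on \<open>y\<close> and
  on \<open>w\<close> from the left.
\<close>

lemma form_brk:
  assumes x: "x \<in> hom G a" and y: "y \<in> hom G b" and w: "w \<in> sspace G"
  shows "\<omega> x (brk G y w) = \<omega> (brk G x y) w + sgn2 (a * b) * \<omega> y (brk G x w)"
  using w
proof (induction w rule: sspace_induct)
  case (hom c w)
  note cyclic_form[OF x y hom]
  moreover have "brk G w x = scl G (- sgn2 (c * a)) (brk G x w)"
    using brk_skew[OF hom x] .
  moreover have "\<omega> w (brk G x y) = - sgn2 (c * (a + b)) * \<omega> (brk G x y) w"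
    using form_skew[OF hom brk_hom[OF x y]] .
  ultimately show ?case using hom_subset[OF x] hom_subset[OF y] hom_subset[OF hom]
    by (cases a; cases b; cases c) (simp_all add: bilin add_eq_0_iff, simp_all add: algebra_simps)
next
  case (add w w')
  then show ?case using hom_subset[OF x] hom_subset[OF y]
    by (simp add: bilin algebra_simps)
qed

subsection \<open>Linear functionals and adjoints\<close>

text \<open>
  A linear functional that vanishes on the common kernel of finitely many functionals \<open>\<omega> v\<close> is a
  linear combination of them. For a spanning set \<open>B\<close> this kernel is zero by non-degeneracy, which
  makes every functional representable.
\<close>

lemma functional_in_span_forms:
  assumes "finite B" "B \<subseteq> sspace G" "linear_between (sspace G) (scl G) (*) \<beta>"
    and "\<And>x. x \<in> sspace G \<Longrightarrow> (\<And>v. v \<in> B \<Longrightarrow> \<omega> v x = 0) \<Longrightarrow> \<beta> x = 0"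
  shows "\<exists>w\<in>sspace G. \<forall>x\<in>sspace G. \<beta> x = \<omega> w x"
  using assms
proof (induction B arbitrary: \<beta> rule: finite_induct)
  case empty
  then show ?case by (intro bexI[of _ 0]) (auto simp: form_zero)
next
  case (insert v B)
  have lin: "\<beta> (x + y) = \<beta> x + \<beta> y" "\<beta> (scl G c x) = c * \<beta> x"
    if "x \<in> sspace G" "y \<in> sspace G" for x y c
    using insert.prems that by (auto simp: linear_between_def)
  have vV: "v \<in> sspace G" using insert.prems by auto
  show ?case
  proof (cases "\<exists>x\<in>sspace G. (\<forall>u\<in>B. \<omega> u x = 0) \<and> \<omega> v x \<noteq> 0")
    case False
    show ?thesis
    proof (rule insert.IH)
      fix x assume "x \<in> sspace G" "\<And>u. u \<in> B \<Longrightarrow> \<omega> u x = 0"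
      then show "\<beta> x = 0" using False insert.prems(3)[of x] by auto
    qed (use insert.prems in auto)
  next
    case True
    then obtain p where p: "p \<in> sspace G" "\<forall>u\<in>B. \<omega> u p = 0" "\<omega> v p \<noteq> 0" by blast
    define c where "c = \<beta> p / \<omega> v p"
    \<comment> \<open>Subtracting a multiple of \<open>\<omega> v\<close> makes the functional vanish at \<open>p\<close>, which spans a
      complement of the kernel of \<open>\<omega> v\<close> inside the common kernel of the remaining forms.\<close>
    have "\<exists>w\<in>sspace G. \<forall>x\<in>sspace G. \<beta> x - c * \<omega> v x = \<omega> w x"
    proof (rule insert.IH)
      show "linear_between (sspace G) (scl G) (*) (\<lambda>x. \<beta> x - c * \<omega> v x)"
        using vV by (auto simp: linear_between_def lin bilin algebra_simps)
      fix x assume x: "x \<in> sspace G" and k: "\<And>u. u \<in> B \<Longrightarrow> \<omega> u x = 0"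
      define t where "t = \<omega> v x / \<omega> v p"
      have "\<beta> (x - scl G t p) = 0"
      proof (rule insert.prems(3))
        fix u assume u: "u \<in> insert v B"
        then have "u \<in> sspace G" using insert.prems by auto
        then show "\<omega> u (x - scl G t p) = 0"
          using u k p x by (auto simp: bilin t_def)
      qed (use x p in simp)
      moreover have "\<beta> (x - scl G t p) = \<beta> x - t * \<beta> p"
        using lin(1)[of x "scl G (- t) p"] lin(2)[of p p "- t"] x p by simp
      ultimately show "\<beta> x - c * \<omega> v x = 0" by (simp add: c_def t_def)
    qed (use insert.prems in auto)
    then obtain w where w: "w \<in> sspace G" "\<forall>x\<in>sspace G. \<beta> x - c * \<omega> v x = \<omega> w x" by blast
    then show ?thesis using vV
      by (intro bexI[of _ "w + scl G c v"]) (auto simp: bilin algebra_simps)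
  qed
qed

lemma functional_represented:
  assumes "linear_between (sspace G) (scl G) (*) \<beta>"
  obtains w where "w \<in> sspace G" "\<And>x. x \<in> sspace G \<Longrightarrow> \<beta> x = \<omega> w x"
proof -
  obtain B where B: "finite B" "V.span B = sspace G"
    using super unfolding super_vector_space_def by blast
  have BV: "B \<subseteq> sspace G" using V.span_superset[of B] B by simp
  have "\<exists>w\<in>sspace G. \<forall>x\<in>sspace G. \<beta> x = \<omega> w x"
  proof (rule functional_in_span_forms[OF B(1) BV assms])
    fix x assume x: "x \<in> sspace G" and k: "\<And>v. v \<in> B \<Longrightarrow> \<omega> v x = 0"
    have left: "\<omega> y x = 0" if "y \<in> sspace G" for y
    proof -
      have "V.subspace {y \<in> sspace G. \<omega> y x = 0}"
        using x by (auto simp: V.subspace_def bilin form_zero)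
      then have "V.span B \<subseteq> {y \<in> sspace G. \<omega> y x = 0}"
        using k BV by (intro V.span_minimal) auto
      then show ?thesis using that B(2) by auto
    qed
    from x obtain u v where uv: "u \<in> hom G 0" "v \<in> hom G 1" "x = u + v" by (rule sspace_cases)
    \<comment> \<open>Left non-degeneracy carries over to the right because each homogeneous component of \<open>x\<close>
      pairs with one degree only.\<close>
    have "x = 0"
    proof (rule form_nondegenerate[OF x])
      fix y assume "y \<in> sspace G"
      then obtain p q where pq: "p \<in> hom G 0" "q \<in> hom G 1" "y = p + q" by (rule sspace_cases)
      have "\<omega> x y = \<omega> u q + \<omega> v p"
        using uv pq form_odd[OF uv(1) pq(1)] form_odd[OF uv(2) pq(2)] by (simp add: bilin hom_subset)
      also have "\<dots> = - (\<omega> q x + \<omega> p x)"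
        using uv pq form_odd[OF pq(1) uv(1)] form_odd[OF pq(2) uv(2)]
          form_skew[OF uv(1) pq(2)] form_skew[OF uv(2) pq(1)] by (simp add: bilin hom_subset)
      also have "\<dots> = 0" using left pq by (simp add: hom_subset)
      finally show "\<omega> x y = 0" .
    qed
    then show "\<beta> x = 0" using assms x unfolding linear_between_def
      by (metis mult_zero_left V.scale_zero_left)
  qed
  then show ?thesis using that by blast
qed

lemma adjoint_map:
  assumes D: "linear_between (sspace G) (scl G) (scl G) D" "\<And>x. x \<in> sspace G \<Longrightarrow> D x \<in> sspace G"
    and x: "x \<in> sspace G"
  shows "adjoint_map G \<omega> D x \<in> sspace G"
    and "y \<in> sspace G \<Longrightarrow> \<omega> (adjoint_map G \<omega> D x) y = \<omega> x (D y)"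
proof -
  have "linear_between (sspace G) (scl G) (*) (\<lambda>y. \<omega> x (D y))"
    using D x by (auto simp: linear_between_def bilin)
  then obtain w where w: "w \<in> sspace G" "\<And>y. y \<in> sspace G \<Longrightarrow> \<omega> x (D y) = \<omega> w y"
    by (rule functional_represented) blast
  then have "adjoint_map G \<omega> D x = w"
    unfolding adjoint_map_def by (intro the_equality form_eqI) auto
  with w show "adjoint_map G \<omega> D x \<in> sspace G"
    "y \<in> sspace G \<Longrightarrow> \<omega> (adjoint_map G \<omega> D x) y = \<omega> x (D y)" by auto
qed

end

section \<open>Splitting off a central element and its dual\<close>

text \<open>
  The element \<open>es\<close> plays the role of $e^*$; the form \<open>\<omega>\<close> pairs its line with that of \<open>e\<close>, which
  has the degree \<open>d\<close> of the extending algebra.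
\<close>

locale central_pair = odd_symplectic_superalgebra G \<omega>
  for G :: "('k::field_char_0, 'v::ab_group_add) superalg" and \<omega> :: "'v \<Rightarrow> 'v \<Rightarrow> 'k" +
  fixes d :: bit and es e :: "'v"
  assumes es: "es \<in> hom G (d + 1)" and e: "e \<in> hom G d" and form_es_e: "\<omega> es e = 1"
    and central: "\<And>x. x \<in> sspace G \<Longrightarrow> brk G x es = 0"
begin

lemma es_in [simp]: "es \<in> sspace G" and e_in [simp]: "e \<in> sspace G"
  using es e by (auto dest: hom_subset)

lemma form_e_es: "\<omega> e es = - 1"
  using form_skew[OF e es] form_es_e by (cases d) simp_all

lemma form_self: "\<omega> es es = 0" "\<omega> e e = 0"
  using form_odd[OF es es] form_odd[OF e e] by auto

lemma central_left: "x \<in> sspace G \<Longrightarrow> brk G es x = 0"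
proof (induction x rule: sspace_induct)
  case (hom a x)
  then show ?case using brk_skew[OF es hom] central[OF hom_subset[OF hom]] by simp
qed (simp add: bilin)

text \<open>
  Closedness rewrites this value into brackets with the central element. The hyperplane orthogonal
  to \<open>es\<close> is therefore an ideal.
\<close>

lemma form_es_brk: "x \<in> sspace G \<Longrightarrow> y \<in> sspace G \<Longrightarrow> \<omega> es (brk G x y) = 0"
proof (induction x rule: sspace_induct)
  case (hom a x)
  then show ?case using form_brk[OF es hom(1,2)] hom_subset[OF hom(1)]
    by (simp add: central_left form_zero)
qed (simp add: bilin)

text \<open>
  The projection along $\mathbb Ke^* \oplus \mathbb Ke$ onto its orthogonal complement. As
  $\omega(e,e^*) = -1$, the coefficients of \<open>x\<close> at \<open>es\<close> and \<open>e\<close> are \<open>- \<omega> e x\<close> and \<open>\<omega> es x\<close>.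
\<close>

definition proj :: "'v \<Rightarrow> 'v" where
  "proj x = x + scl G (\<omega> e x) es - scl G (\<omega> es x) e"

text \<open>
  The symplectic reduction $(e^*)^\perp/\mathbb Ke^*$. Each coset has exactly one representative that
  is also orthogonal to \<open>e\<close>, and the reduction is modelled on these representatives.
\<close>

definition reduct :: "('k, 'v) superalg" where
  "reduct = \<lparr>scl = scl G, hom = (\<lambda>a. {x \<in> hom G a. \<omega> es x = 0 \<and> \<omega> e x = 0}),
     brk = (\<lambda>x y. proj (brk G x y))\<rparr>"

lemma reduct_sel [simp]: "scl reduct = scl G" "brk reduct x y = proj (brk G x y)"
  by (simp_all add: reduct_def)

lemma hom_reduct: "x \<in> hom reduct a \<longleftrightarrow> x \<in> hom G a \<and> \<omega> es x = 0 \<and> \<omega> e x = 0"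
  by (simp add: reduct_def)

lemma form_hom_other:
  assumes "x \<in> hom G a"
  shows "a \<noteq> d \<Longrightarrow> \<omega> es x = 0" "a = d \<Longrightarrow> \<omega> e x = 0"
proof -
  show "\<omega> es x = 0" if "a \<noteq> d"
  proof -
    have "a = d + 1" using that by (cases a; cases d) simp_all
    then show ?thesis using assms es form_odd by blast
  qed
qed (use assms e form_odd in blast)

text \<open>
  As \<open>e\<close> and \<open>es\<close> have opposite degrees, each of the two orthogonality conditions is automatic in
  one degree, so both pass to the homogeneous components.
\<close>

lemma sspace_reduct: "x \<in> sspace reduct \<longleftrightarrow> x \<in> sspace G \<and> \<omega> es x = 0 \<and> \<omega> e x = 0"
proof
  assume "x \<in> sspace reduct"
  then obtain u v where "u \<in> hom reduct 0" "v \<in> hom reduct 1" "x = u + v" by (rule sspace_cases)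
  then show "x \<in> sspace G \<and> \<omega> es x = 0 \<and> \<omega> e x = 0"
    by (auto simp: hom_reduct hom_subset bilin)
next
  assume x: "x \<in> sspace G \<and> \<omega> es x = 0 \<and> \<omega> e x = 0"
  then have "x \<in> sspace G" by simp
  then obtain u v where uv: "u \<in> hom G 0" "v \<in> hom G 1" "x = u + v" by (rule sspace_cases)
  have "\<omega> es u = 0 \<and> \<omega> es v = 0 \<and> \<omega> e u = 0 \<and> \<omega> e v = 0"
    using x uv form_hom_other[OF uv(1)] form_hom_other[OF uv(2)]
    by (cases d) (auto simp: bilin hom_subset)
  then show "x \<in> sspace reduct"
    using uv unfolding sspace_def by (auto simp: hom_reduct)
qed

lemma reduct_in [simp]: "x \<in> sspace reduct \<Longrightarrow> x \<in> sspace G"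
  and reduct_orth [simp]: "x \<in> sspace reduct \<Longrightarrow> \<omega> es x = 0" "x \<in> sspace reduct \<Longrightarrow> \<omega> e x = 0"
  using sspace_reduct by auto

lemma reduct_memI: "x \<in> sspace G \<Longrightarrow> \<omega> es x = 0 \<Longrightarrow> \<omega> e x = 0 \<Longrightarrow> x \<in> sspace reduct"
  using sspace_reduct by auto

lemma hom_reduct_in: "x \<in> hom reduct a \<Longrightarrow> x \<in> sspace reduct"
  by (rule reduct_memI) (auto simp: hom_reduct hom_subset)

lemma form_reduct_es: "x \<in> sspace reduct \<Longrightarrow> \<omega> x es = 0"
  and form_reduct_e: "x \<in> sspace reduct \<Longrightarrow> \<omega> x e = 0"
proof -
  assume x: "x \<in> sspace reduct"
  then obtain u v where uv: "u \<in> hom reduct 0" "v \<in> hom reduct 1" "x = u + v"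
    by (rule sspace_cases)
  then have uv': "u \<in> hom G 0" "v \<in> hom G 1" by (auto simp: hom_reduct)
  then show "\<omega> x es = 0" "\<omega> x e = 0"
    using uv form_skew[OF uv'(1) es] form_skew[OF uv'(2) es] form_skew[OF uv'(1) e]
      form_skew[OF uv'(2) e] by (auto simp: hom_reduct hom_subset bilin)
qed

lemma proj_in [simp]: "x \<in> sspace G \<Longrightarrow> proj x \<in> sspace reduct"
  by (rule reduct_memI) (simp_all add: proj_def bilin form_es_e form_e_es form_self)

lemma proj_hom: "x \<in> hom G a \<Longrightarrow> proj x \<in> hom reduct a"
proof -
  assume x: "x \<in> hom G a"
  have "scl G (\<omega> e x) es \<in> hom G a"
    using form_hom_other(2)[OF x] hom_closed es by (cases a; cases d) auto
  moreover have "scl G (\<omega> es x) e \<in> hom G a"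
    using form_hom_other(1)[OF x] hom_closed e by (cases a; cases d) auto
  ultimately have "proj x \<in> hom G a" unfolding proj_def using x hom_closed by metis
  then show ?thesis using proj_in[OF hom_subset[OF x]] by (simp add: hom_reduct)
qed

lemma proj_add: "x \<in> sspace G \<Longrightarrow> y \<in> sspace G \<Longrightarrow> proj (x + y) = proj x + proj y"
  by (simp add: proj_def bilin V.scale_left_distrib algebra_simps)

lemma proj_scale: "x \<in> sspace G \<Longrightarrow> proj (scl G c x) = scl G c (proj x)"
  by (simp add: proj_def bilin V.scale_right_distrib V.scale_right_diff_distrib)

lemma proj_zero: "proj 0 = 0"
  by (simp add: proj_def form_zero)

lemma proj_orth: "\<omega> es x = 0 \<Longrightarrow> proj x = x + scl G (\<omega> e x) es"
  by (simp add: proj_def)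

text \<open>On the hyperplane orthogonal to \<open>es\<close> the projection only changes multiples of the central
  element, so it is invisible inside brackets and against elements of the reduct.\<close>

lemma brk_proj:
  assumes "\<omega> es x = 0" "x \<in> sspace G" "y \<in> sspace G"
  shows "brk G (proj x) y = brk G x y" "brk G y (proj x) = brk G y x"
  using assms by (simp_all add: proj_orth bilin central central_left)

lemma form_proj:
  assumes "x \<in> sspace reduct" "y \<in> sspace G"
  shows "\<omega> x (proj y) = \<omega> x y" "\<omega> (proj y) x = \<omega> y x"
  using assms by (simp_all add: proj_def bilin form_reduct_es form_reduct_e)

lemma span_reduct: "module.span (scl G) (sspace reduct) = sspace reduct"
  and subspace_reduct: "module.subspace (scl G) (sspace reduct)"
proof -
  show *: "V.subspace (sspace reduct)"
    by (intro V.subspaceI reduct_memI) (simp_all add: bilin form_zero)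
  then show "V.span (sspace reduct) = sspace reduct" by (simp add: V.span_eq_iff)
qed

lemma e_not_in_reduct: "e \<notin> sspace reduct"
  using reduct_orth(1)[of e] form_es_e by auto

text \<open>
  A basis of the reduct stays independent after adjoining \<open>e\<close>, which is not orthogonal to \<open>es\<close>. So
  the enlarged set is no larger than a spanning set of the whole space.
\<close>

lemma basis_reduct:
  assumes "finite B" "module.span (scl G) B = sspace G"
  obtains B' where "finite B'" "module.span (scl G) B' = sspace reduct" "card B' < card B"
proof -
  obtain B' where B': "B' \<subseteq> sspace reduct" "\<not> V.dependent B'" "sspace reduct \<subseteq> V.span B'"
    using V.maximal_independent_subset[of "sspace reduct"] by blast
  have span: "V.span B' = sspace reduct"
    using V.span_mono[OF B'(1)] span_reduct B'(3) by auto
  have "\<not> V.dependent (insert e B')"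
    using V.independent_insertI B'(2) e_not_in_reduct span by auto
  moreover have "insert e B' \<subseteq> V.span B" using B'(1) assms(2) by auto
  ultimately have "finite (insert e B') \<and> card (insert e B') \<le> card B"
    by (rule V.independent_span_bound[OF assms(1)])
  moreover have "e \<notin> B'" using B'(1) e_not_in_reduct by auto
  ultimately show ?thesis using span by (intro that[of B']) auto
qed

subsection \<open>The reduct is odd-symplectic\<close>

lemma super_reduct: "super_vector_space reduct"
proof -
  obtain B where "finite B" "V.span B = sspace G"
    using super unfolding super_vector_space_def by blast
  then obtain B' where "finite B'" "V.span B' = sspace reduct" by (rule basis_reduct)
  moreover have "V.subspace (hom reduct a)" for a
    using hom_closed hom_subset by (auto simp: V.subspace_def hom_reduct bilin form_zero)
  moreover have "hom reduct 0 \<inter> hom reduct 1 = {0}"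
    using hom_Int hom_closed(1) by (auto simp: hom_reduct form_zero)
  ultimately show ?thesis
    unfolding super_vector_space_def using V.vector_space_axioms by auto
qed

lemma lie_reduct: "lie_superalgebra reduct"
  unfolding lie_superalgebra_def
proof (intro conjI allI ballI)
  show "super_vector_space reduct" by (rule super_reduct)
  show "bilinear_between (sspace reduct) (scl reduct) (scl reduct) (brk reduct)"
    by (simp add: bilinear_between_def linear_between_def bilin proj_add proj_scale)
next
  fix a b x y assume "x \<in> hom reduct a" "y \<in> hom reduct b"
  then show "brk reduct x y \<in> hom reduct (a + b)"
    using proj_hom[OF brk_hom[of x a y b]] by (simp add: hom_reduct[of x] hom_reduct[of y])
next
  fix a b x y assume "x \<in> hom reduct a" "y \<in> hom reduct b"
  then show "brk reduct x y = scl reduct (- sgn2 (a * b)) (brk reduct y x)"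
    using brk_skew[of x a y b] proj_scale[of "brk G y x" "- sgn2 (a * b)"]
    by (auto simp only: reduct_sel hom_reduct hom_subset brk_closed)
next
  fix a b c x y w assume xyw: "x \<in> hom reduct a" "y \<in> hom reduct b" "w \<in> hom reduct c"
  then have hom: "x \<in> hom G a" "y \<in> hom G b" "w \<in> hom G c" by (auto simp: hom_reduct)
  note [simp] = hom_subset[OF hom(1)] hom_subset[OF hom(2)] hom_subset[OF hom(3)]
  show "scl reduct (sgn2 (c * a)) (brk reduct x (brk reduct y w))
    + scl reduct (sgn2 (a * b)) (brk reduct y (brk reduct w x))
    + scl reduct (sgn2 (b * c)) (brk reduct w (brk reduct x y)) = 0"
    using arg_cong[OF cyclic_jacobi[OF hom], of proj]
    by (simp add: brk_proj form_es_brk proj_add proj_scale proj_zero)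
qed

lemma form_reduct: "odd_symplectic_form reduct \<omega>"
  unfolding odd_symplectic_form_def
proof (intro conjI allI ballI impI)
  show "bilinear_between (sspace reduct) (scl reduct) (*) \<omega>"
    by (simp add: bilinear_between_def linear_between_def bilin)
next
  fix a x y assume "x \<in> hom reduct a" "y \<in> hom reduct a"
  then show "\<omega> x y = 0" using form_odd by (auto simp: hom_reduct)
next
  fix a b x y assume "x \<in> hom reduct a" "y \<in> hom reduct b"
  then show "\<omega> x y = - sgn2 (a * b) * \<omega> y x" using form_skew by (auto simp: hom_reduct)
next
  fix x assume x: "x \<in> sspace reduct" "\<forall>y\<in>sspace reduct. \<omega> x y = 0"
  show "x = 0"
  proof (rule form_nondegenerate)
    fix y assume "y \<in> sspace G"
    then show "\<omega> x y = 0" using x form_proj(1)[of x y] by (metis proj_in)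
  qed (use x in simp)
next
  fix a b c x y w assume xyw: "x \<in> hom reduct a" "y \<in> hom reduct b" "w \<in> hom reduct c"
  then have hom: "x \<in> hom G a" "y \<in> hom G b" "w \<in> hom G c" by (auto simp: hom_reduct)
  note [simp] = hom_subset[OF hom(1)] hom_subset[OF hom(2)] hom_subset[OF hom(3)]
  show "sgn2 (c * a) * \<omega> x (brk reduct y w) + sgn2 (a * b) * \<omega> y (brk reduct w x)
    + sgn2 (b * c) * \<omega> w (brk reduct x y) = 0"
    using cyclic_form[OF hom] xyw by (simp add: form_proj hom_reduct_in)
qed

lemma odd_symplectic_reduct: "odd_symplectic reduct \<omega>"
  by (simp add: odd_symplectic_def lie_reduct form_reduct)

text \<open>
  A bracket in the reduct differs from the same bracket in the whole algebra by a multiple of the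
  central element, and such a multiple does not affect any further bracket.
\<close>

lemma lower_central_reduct:
  "x \<in> lower_central reduct n \<Longrightarrow> x \<in> sspace reduct \<and> (\<exists>r. x + scl G r es \<in> lower_central G n)"
proof (induction n arbitrary: x)
  case 0
  then show ?case by (auto intro: exI[of _ 0])
next
  case (Suc n)
  let ?L = "lower_central G (Suc n)"
  let ?S = "{x \<in> sspace reduct. \<exists>r. x + scl G r es \<in> ?L}"
  have L: "V.subspace ?L" by (simp add: V.subspace_span)
  have "V.subspace ?S"
  proof (rule V.subspaceI)
    show "0 \<in> ?S" using V.subspace_0[OF subspace_reduct] V.subspace_0[OF L]
      by (auto intro: exI[of _ 0])
  next
    fix x y assume "x \<in> ?S" "y \<in> ?S"
    then obtain r t where xy: "x \<in> sspace reduct" "y \<in> sspace reduct"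
      and "x + scl G r es \<in> ?L" "y + scl G t es \<in> ?L" by blast
    then have "(x + scl G r es) + (y + scl G t es) \<in> ?L" using V.subspace_add[OF L] by blast
    then have "(x + y) + scl G (r + t) es \<in> ?L"
      by (simp only: V.scale_left_distrib ac_simps)
    then show "x + y \<in> ?S" using V.subspace_add[OF subspace_reduct xy] by blast
  next
    fix c x assume "x \<in> ?S"
    then obtain r where x: "x \<in> sspace reduct" and "x + scl G r es \<in> ?L" by blast
    then have "scl G c (x + scl G r es) \<in> ?L" using V.subspace_scale[OF L] by blast
    then have "scl G c x + scl G (c * r) es \<in> ?L"
      by (simp only: V.scale_right_distrib V.scale_scale)
    then show "scl G c x \<in> ?S" using V.subspace_scale[OF subspace_reduct x] by blast
  qed
  moreover have "{brk reduct x y |x y. x \<in> sspace reduct \<and> y \<in> lower_central reduct n} \<subseteq> ?S"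
  proof safe
    fix x y assume x: "x \<in> sspace reduct" and y: "y \<in> lower_central reduct n"
    then obtain r where r: "y \<in> sspace reduct" "y + scl G r es \<in> lower_central G n"
      using Suc.IH by blast
    then show "brk reduct x y \<in> sspace reduct" using x by simp
    have "brk G x (y + scl G r es) \<in> ?L"
      unfolding lower_central.simps using x r reduct_in by (intro V.span_base) blast
    then have "brk G x y \<in> ?L" using x r by (simp add: bilin central)
    then have "brk reduct x y + scl G (- \<omega> e (brk G x y)) es \<in> ?L"
      using x r by (simp add: proj_orth form_es_brk)
    then show "\<exists>r. brk reduct x y + scl G r es \<in> ?L" by blast
  qed
  ultimately have "lower_central reduct (Suc n) \<subseteq> ?S"
    using V.span_minimal by simp
  then show ?case using Suc.prems by blast
qed

text \<open>
  Where the lower central series of the whole algebra vanishes, an element of that of the reduct is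
  a multiple of \<open>es\<close>; such a multiple is orthogonal to \<open>e\<close> only if it is zero.
\<close>

lemma nilpotent_reduct:
  assumes "nilpotent G"
  shows "nilpotent reduct"
proof -
  obtain n where n: "lower_central G n = {0}" using assms unfolding nilpotent_def by blast
  have "x = 0" if "x \<in> lower_central reduct n" for x
  proof -
    obtain r where x: "x \<in> sspace reduct" and "x + scl G r es = 0"
      using lower_central_reduct[OF \<open>x \<in> _\<close>] n by auto
    then have eq: "x = scl G (- r) es" by (simp add: eq_neg_iff_add_eq_0)
    then have "r = 0" using reduct_orth(2)[OF x] by (simp add: bilin form_e_es)
    then show ?thesis using eq by simp
  qed
  moreover have "0 \<in> lower_central reduct n"
    by (cases n) (simp_all add: V.subspace_0[OF subspace_reduct] V.span_zero)
  ultimately show ?thesis unfolding nilpotent_def by blast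
qed

subsection \<open>The whole algebra is an extension of the reduct\<close>

text \<open>
  The superderivation $D$ of the extension. It is the action of \<open>e\<close> on the quotient
  $(e^*)^\perp/\mathbb Ke^*$, hence a superderivation by the Leibniz form of the Jacobi identity.
\<close>

definition outer :: "'v \<Rightarrow> 'v" where
  "outer x = proj (brk G e x)"

lemma outer_in [simp]: "x \<in> sspace reduct \<Longrightarrow> outer x \<in> sspace reduct"
  by (simp add: outer_def)

lemma outer_linear: "linear_between (sspace reduct) (scl reduct) (scl reduct) outer"
  by (simp add: linear_between_def outer_def bilin proj_add proj_scale)

lemma superderivation_outer: "superderivation reduct d outer"
  unfolding superderivation_def
proof (intro conjI allI ballI)
  fix a x assume x: "x \<in> hom reduct a"
  show "outer x \<in> hom reduct (a + d)"
    unfolding outer_def add.commute[of a] using x by (intro proj_hom brk_hom e) (simp add: hom_reduct)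
next
  fix a x y assume x: "x \<in> hom reduct a" and y: "y \<in> sspace reduct"
  then have x': "x \<in> hom G a" by (simp add: hom_reduct)
  then show "outer (brk reduct x y)
    = brk reduct (outer x) y + scl reduct (sgn2 (d * a)) (brk reduct x (outer y))"
    using arg_cong[OF leibniz[OF e x', of y], of proj] y hom_subset[OF x']
    by (simp add: outer_def brk_proj form_es_brk proj_add proj_scale)
qed (rule outer_linear)

lemma twist_reduct:
  assumes "u \<in> hom reduct 0" "v \<in> hom reduct 1"
  shows "twist reduct d (u + v) = u + scl G (sgn2 d) v"
  using twist_add[OF super_reduct assms, of d] by simp

lemma twist_reduct_in [simp]:
  assumes "x \<in> sspace reduct"
  shows "twist reduct d x \<in> sspace reduct"
proof -
  obtain u v where uv: "u \<in> hom reduct 0" "v \<in> hom reduct 1" "x = u + v"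
    using assms by (rule sspace_cases)
  then show ?thesis
    using V.subspace_add[OF subspace_reduct] V.subspace_scale[OF subspace_reduct] hom_reduct_in
    by (simp add: twist_reduct)
qed

lemma brk_e_right:
  assumes "x \<in> sspace reduct"
  shows "brk G x e = - brk G e (twist reduct d x)"
proof -
  obtain u v where uv: "u \<in> hom reduct 0" "v \<in> hom reduct 1" "x = u + v"
    using assms by (rule sspace_cases)
  then have uv': "u \<in> hom G 0" "v \<in> hom G 1" by (auto simp: hom_reduct)
  moreover have "twist reduct d x = u + scl G (sgn2 d) v"
    using twist_reduct uv by simp
  ultimately show ?thesis
    using uv(3) brk_skew[OF uv'(1) e] brk_skew[OF uv'(2) e]
    by (cases d) (simp_all add: hom_subset[OF uv'(1)] hom_subset[OF uv'(2)] bilin)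
qed

text \<open>Closedness of \<open>\<omega>\<close> on \<open>e\<close> and two elements of the reduct forces the coefficient of \<open>es\<close> in
  their bracket, which is \<open>- \<omega> e\<close> of it, to be the cocycle of the extension.\<close>

lemma ext_cocycle_outer:
  assumes "x \<in> sspace reduct" and y: "y \<in> sspace reduct"
  shows "ext_cocycle reduct \<omega> d outer x y = - \<omega> e (brk G x y)"
proof -
  obtain u v where uv: "u \<in> hom reduct 0" "v \<in> hom reduct 1" "x = u + v"
    using assms(1) by (rule sspace_cases)
  then have uv': "u \<in> hom G 0" "v \<in> hom G 1" by (auto simp: hom_reduct)
  note [simp] = hom_subset[OF uv'(1)] hom_subset[OF uv'(2)]
    hom_reduct_in[OF uv(1)] hom_reduct_in[OF uv(2)]
  show ?thesis
    using uv y form_brk[OF e uv'(1), of y] form_brk[OF e uv'(2), of y]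
    by (simp add: ext_cocycle_def twist_reduct outer_def form_proj bilin proj_add algebra_simps)
qed

lemma scale_2: "scl G 2 x = x + x"
  using V.scale_left_distrib[of 1 1 x] by simp

lemma scale_3: "scl G 3 x = x + x + x"
  using V.scale_left_distrib[of 2 1 x] by (simp add: scale_2)

lemma brk_e_e_hom: "brk G e e \<in> hom G 0"
  using brk_hom[OF e e] by simp

lemma brk_e_e_even:
  assumes "d = 0"
  shows "brk G e e = 0"
proof -
  have "brk G e e = - brk G e e" using brk_skew[OF e e] assms by simp
  then have "scl G 2 (brk G e e) = 0" unfolding scale_2 by (metis add.right_inverse)
  then show ?thesis by simp
qed

text \<open>
  For odd \<open>e\<close> the three terms of closedness on \<open>(e, e, e)\<close> coincide, so three times the value is zero.
\<close>

lemma form_e_brk_e_e: "\<omega> e (brk G e e) = 0"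
proof (cases "d = 0")
  case True
  then show ?thesis by (simp add: brk_e_e_even form_zero)
next
  case False
  then have d: "d = 1" by simp
  have "3 * \<omega> e (brk G e e) = 0"
    using form_brk[OF e e e_in] form_skew[OF brk_e_e_hom e] d by (simp add: algebra_simps)
  then show ?thesis by simp
qed

lemma brk_e_e: "brk G e e \<in> hom reduct 0"
  using brk_e_e_hom form_e_brk_e_e by (simp add: hom_reduct form_es_brk)

lemma brk_e_e_in [simp]: "brk G e e \<in> sspace reduct"
  using brk_e_e by (rule hom_reduct_in)

definition embed :: "'k \<times> 'v \<times> 'k \<Rightarrow> 'v" where
  "embed = (\<lambda>(r, x, a). scl G r es + x + scl G a e)"

definition coords :: "'v \<Rightarrow> 'k \<times> 'v \<times> 'k" where
  "coords v = (- \<omega> e v, proj v, \<omega> es v)"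

lemma embed_coords: "v \<in> sspace G \<Longrightarrow> embed (coords v) = v"
  by (simp add: embed_def coords_def proj_def)

lemma coords_embed: "x \<in> sspace reduct \<Longrightarrow> coords (embed (r, x, a)) = (r, x, a)"
proof -
  assume x: "x \<in> sspace reduct"
  have "\<omega> e (embed (r, x, a)) = - r" "\<omega> es (embed (r, x, a)) = a"
    using x by (simp_all add: embed_def bilin form_es_e form_e_es form_self)
  then show ?thesis by (simp add: coords_def proj_def embed_def)
qed

lemma brk_embed:
  assumes x: "x \<in> sspace reduct" and y: "y \<in> sspace reduct"
  shows "brk G (embed (r, x, a)) (embed (s, y, b))
    = brk G x y + scl G a (brk G e y) - scl G b (brk G e (twist reduct d x))
      + scl G (a * b) (brk G e e)"
proof -
  have "brk G (embed (r, x, a)) (embed (s, y, b))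
    = brk G x y + scl G b (brk G x e) + scl G a (brk G e y) + scl G (a * b) (brk G e e)"
    using x y by (simp add: embed_def bilin central central_left V.scale_right_distrib algebra_simps)
  then show ?thesis using brk_e_right[OF x] by (simp add: algebra_simps)
qed

text \<open>
  Both kinds of extension are covered at once: apart from the degree of \<open>e\<close>, they differ only in
  $[e,e]$ and in the functional \<open>\<beta>\<close>, which has to be minus the \<open>es\<close>-coefficient of $[e,\cdot]$.
\<close>

lemma symplectic_iso_embed:
  assumes \<beta>: "\<And>x. x \<in> sspace reduct \<Longrightarrow> \<beta> x = \<omega> e (brk G e x)"
  shows "symplectic_iso (ext_alg reduct \<omega> d outer (brk G e e) \<beta>) (ext_form \<omega>) G \<omega> embed"
proof -
  define E where "E = ext_alg reduct \<omega> d outer (brk G e e) \<beta>"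
  have scl_E: "scl E c (r, x, a) = (c * r, scl G c x, c * a)" for c r x a
    by (simp add: E_def ext_alg_def)
  have hom_E: "(r, x, a) \<in> hom E i \<longleftrightarrow>
      x \<in> hom reduct i \<and> (i \<noteq> d + 1 \<longrightarrow> r = 0) \<and> (i \<noteq> d \<longrightarrow> a = 0)" for r x a i
    by (simp add: E_def ext_alg_def)
  have brk_E: "brk E (r, x, a) (s, y, b) =
      (ext_cocycle reduct \<omega> d outer x y - a * \<beta> y + b * \<beta> (twist reduct d x),
       proj (brk G x y) + scl G a (outer y) - scl G b (outer (twist reduct d x))
         + scl G (a * b) (brk G e e), 0)" for r x a s y b
    by (simp add: E_def ext_alg_def)
  have sspace_E: "(r, x, a) \<in> sspace E \<longleftrightarrow> x \<in> sspace reduct" for r x a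
  proof
    assume "(r, x, a) \<in> sspace E"
    then obtain p q where "p \<in> hom E 0" "q \<in> hom E 1" "(r, x, a) = p + q" by (rule sspace_cases)
    then show "x \<in> sspace reduct"
      by (cases p; cases q) (auto simp: hom_E sspace_def)
  next
    assume "x \<in> sspace reduct"
    then obtain u v where uv: "u \<in> hom reduct 0" "v \<in> hom reduct 1" "x = u + v"
      by (rule sspace_cases)
    show "(r, x, a) \<in> sspace E"
    proof (cases "d = 0")
      case True
      then have "(0, u, a) \<in> hom E 0" "(r, v, 0) \<in> hom E 1" using uv by (simp_all add: hom_E)
      moreover have "(r, x, a) = (0, u, a) + (r, v, 0)" using uv by simp
      ultimately show ?thesis unfolding sspace_def by blast
    next
      case False
      then have "d = 1" by simp
      then have "(r, u, 0) \<in> hom E 0" "(0, v, a) \<in> hom E 1" using uv by (simp_all add: hom_E)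
      moreover have "(r, x, a) = (r, u, 0) + (0, v, a)" using uv by simp
      ultimately show ?thesis unfolding sspace_def by blast
    qed
  qed
  have "symplectic_iso E (ext_form \<omega>) G \<omega> embed"
    unfolding symplectic_iso_def
  proof (intro conjI allI ballI)
    show "linear_between (sspace E) (scl E) (scl G) embed"
      by (auto simp: linear_between_def sspace_E scl_E embed_def algebra_simps
          V.scale_left_distrib V.scale_right_distrib)
    show "bij_betw embed (sspace E) (sspace G)"
    proof (rule bij_betw_byWitness[of _ coords])
      show "\<forall>p\<in>sspace E. coords (embed p) = p" using coords_embed sspace_E by auto
      show "\<forall>v\<in>sspace G. embed (coords v) = v" using embed_coords by auto
      show "embed ` sspace E \<subseteq> sspace G" by (auto simp: sspace_E embed_def)
      show "coords ` sspace G \<subseteq> sspace E" by (auto simp: sspace_E coords_def)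
    qed
  next
    fix i
    show "embed ` hom E i = hom G i"
    proof
      show "embed ` hom E i \<subseteq> hom G i"
      proof clarify
        fix r x a assume p: "(r, x, a) \<in> hom E i"
        have "scl G r es \<in> hom G i" "scl G a e \<in> hom G i"
          using p es e hom_closed by (cases "i = d"; cases d; auto simp: hom_E)+
        then show "embed (r, x, a) \<in> hom G i"
          using p hom_closed(2) by (auto simp: embed_def hom_E hom_reduct)
      qed
      show "hom G i \<subseteq> embed ` hom E i"
      proof
        fix x assume x: "x \<in> hom G i"
        then have "coords x \<in> hom E i"
          using form_hom_other[OF x] proj_hom[OF x] by (cases i; cases d) (auto simp: coords_def hom_E)
        then show "x \<in> embed ` hom E i"
          using embed_coords[OF hom_subset[OF x]] by (metis imageI)
      qed
    qed
  next
    fix p q assume p: "p \<in> sspace E" and q: "q \<in> sspace E"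
    obtain r x a s y b where pq: "p = (r, x, a)" "q = (s, y, b)" by (cases p; cases q) auto
    have x: "x \<in> sspace reduct" and y: "y \<in> sspace reduct" using p q by (auto simp: pq sspace_E)
    show "\<omega> (embed p) (embed q) = ext_form \<omega> p q"
      using x y by (simp add: pq embed_def ext_form_def bilin form_reduct_e form_reduct_es form_es_e
          form_e_es form_self)
    \<comment> \<open>Every bracket is its projection plus a multiple of \<open>es\<close>; the multiples that occur are the
      values of the cocycle and of \<open>\<beta>\<close>.\<close>
    show "embed (brk E p q) = brk G (embed p) (embed q)"
      unfolding pq brk_embed[OF x y] brk_E ext_cocycle_outer[OF x y]
      using x y by (simp add: embed_def outer_def proj_orth form_es_brk \<beta> algebra_simps
          V.scale_left_distrib V.scale_right_distrib V.scale_left_diff_distrib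
          V.scale_right_diff_distrib)
  qed
  then show ?thesis by (simp add: E_def)
qed

text \<open>
  Two applications of the cocycle formula express $\omega(b_0,[X,Y]) = \omega(e,[e,[X,Y]])$, expanded
  by the Leibniz rule, as $\omega(D^2X,Y) + 2\omega(DX,DY) + \omega(X,D^2Y)$. Moving $D$ from the
  second argument to the first turns this into the required operator $D^*(D+D^*)+(D+D^*)D$.
\<close>

lemma double_ext_of_reduct:
  assumes d: "d = 0"
  shows "is_double_ext_of G \<omega> reduct \<omega>"
proof -
  interpret R: odd_symplectic_superalgebra reduct \<omega>
    by unfold_locales (rule odd_symplectic_reduct)
  have "linear_between (sspace reduct) (scl reduct) (*) (\<lambda>x. \<omega> e (brk G e x))"
    by (simp add: linear_between_def bilin)
  then obtain w where w: "w \<in> sspace reduct" "\<And>x. x \<in> sspace reduct \<Longrightarrow> \<omega> e (brk G e x) = \<omega> w x"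
    by (rule R.functional_represented) blast
  obtain b v where bv: "b \<in> hom reduct 0" "v \<in> hom reduct 1" "w = b + v"
    using w(1) by (rule sspace_cases)
  note [simp] = R.hom_subset[OF bv(1)] R.hom_subset[OF bv(2)]
  \<comment> \<open>The functional vanishes on even elements, so the even part of its representing vector
    already represents it.\<close>
  have b: "\<omega> b x = \<omega> e (brk G e x)" if x: "x \<in> sspace reduct" for x
  proof -
    obtain p q where pq: "p \<in> hom reduct 0" "q \<in> hom reduct 1" "x = p + q"
      using x by (rule sspace_cases)
    note [simp] = R.hom_subset[OF pq(1)] R.hom_subset[OF pq(2)]
    have "brk G e p \<in> hom G d" using brk_hom[OF e, of p 0] pq d by (simp add: hom_reduct)
    then have "\<omega> e (brk G e x) = \<omega> e (brk G e q)" using form_odd[OF e] pq by (simp add: bilin)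
    also have "\<dots> = \<omega> b q" using w(2)[of q] bv R.form_odd[OF bv(2) pq(2)] by (simp add: bilin)
    also have "\<dots> = \<omega> b x" using pq R.form_odd[OF bv(1) pq(1)] by (simp add: bilin)
    finally show ?thesis by simp
  qed
  have twist: "twist reduct d x = x" if x: "x \<in> sspace reduct" for x
  proof -
    obtain u v where uv: "u \<in> hom reduct 0" "v \<in> hom reduct 1" "x = u + v"
      using x by (rule sspace_cases)
    then show ?thesis using twist_reduct[OF uv(1,2)] d by simp
  qed
  define D' where "D' = adjoint_map reduct \<omega> outer"
  have D'_in [simp]: "D' x \<in> sspace reduct" if "x \<in> sspace reduct" for x
    unfolding D'_def using R.adjoint_map(1)[OF outer_linear _ that] by simp
  have D': "\<omega> (D' x) y = \<omega> x (outer y)" if "x \<in> sspace reduct" "y \<in> sspace reduct" for x y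
    unfolding D'_def using R.adjoint_map(2)[OF outer_linear _ that] by simp
  have sum_in [simp]: "x + y \<in> sspace reduct" if "x \<in> sspace reduct" "y \<in> sspace reduct" for x y
    using that V.subspace_add[OF subspace_reduct] by blast
  have "double_ext_datum reduct \<omega> outer b"
    unfolding double_ext_datum_def Let_def D'_def[symmetric]
  proof (intro conjI ballI)
    show "superderivation reduct 0 outer" using superderivation_outer d by simp
    show "b \<in> hom reduct 0" by fact
    fix x y assume x: "x \<in> sspace reduct" and y: "y \<in> sspace reduct"
    have coc: "\<omega> e (brk G x y) = \<omega> (outer x) y + \<omega> x (outer y)"
      if "x \<in> sspace reduct" "y \<in> sspace reduct" for x y
      using ext_cocycle_outer[OF that]
      unfolding ext_cocycle_def twist[OF that(1)] neg_equal_iff_equal by (rule sym)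
    have leib: "brk G e (brk G x y) = brk G (brk G e x) y + brk G x (brk G e y)"
      using x
    proof (rule sspace_cases)
      fix u v assume uv: "u \<in> hom reduct 0" "v \<in> hom reduct 1" "x = u + v"
      then have uv': "u \<in> hom G 0" "v \<in> hom G 1" by (auto simp: hom_reduct)
      then show ?thesis
        using uv leibniz[OF e uv'(1), of y] leibniz[OF e uv'(2), of y] y d
        by (simp add: hom_subset[OF uv'(1)] hom_subset[OF uv'(2)] bilin)
    qed
    have "\<omega> b (brk reduct x y) = \<omega> e (brk G e (brk G x y))"
      using x y by (simp add: b brk_proj form_es_brk)
    also have "\<dots> = \<omega> e (brk G (outer x) y) + \<omega> e (brk G x (outer y))"
      using x y by (simp add: leib bilin outer_def brk_proj form_es_brk)
    also have "\<dots> = \<omega> (outer (outer x)) y + 2 * \<omega> (outer x) (outer y) + \<omega> x (outer (outer y))"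
      using x y by (simp add: coc)
    also have "\<dots> = \<omega> (D' (outer x + D' x) + (outer (outer x) + D' (outer x))) y"
      using x y by (simp add: bilin D')
    finally show "\<omega> (D' (outer x + D' x) + (outer (outer x) + D' (outer x))) y
      = \<omega> b (brk reduct x y)" by simp
  qed
  moreover have "symplectic_iso (double_ext reduct \<omega> outer b) (ext_form \<omega>) G \<omega> embed"
    using symplectic_iso_embed[of "\<lambda>x. \<omega> b x"] b by (simp add: double_ext_def brk_e_e_even d)
  ultimately show ?thesis
    unfolding is_double_ext_of_def using odd_symplectic odd_symplectic_reduct by blast
qed

text \<open>
  With \<open>e\<close> odd, the Leibniz rule for $[e,[e,X]]$ reproduces that bracket with the opposite sign, so
  $2[e,[e,X]] = [[e,e],X]$. For $X = e$ skew-supersymmetry turns this into $3[e,[e,e]] = 0$. The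
  value of $\omega(e,[e,X])$ is found from closedness in the same manner.
\<close>

lemma gen_double_ext_of_reduct:
  assumes d: "d = 1"
  shows "is_gen_double_ext_of G \<omega> reduct \<omega>"
proof -
  have "gen_double_ext_datum reduct outer (brk G e e)"
    unfolding gen_double_ext_datum_def
  proof (intro conjI ballI)
    show "superderivation reduct 1 outer" using superderivation_outer d by simp
    show "brk G e e \<in> hom reduct 0" by (rule brk_e_e)
  next
    fix x assume x: "x \<in> sspace reduct"
    have "scl G 2 (brk G e (brk G e x)) = brk G (brk G e e) x"
      using leibniz[OF e e, of x] x d by (simp add: scale_2 eq_diff_eq)
    then have "scl G (1 / 2) (scl G 2 (brk G e (brk G e x))) = scl G (1 / 2) (brk G (brk G e e) x)"
      by simp
    then have "brk G e (brk G e x) = scl G (1 / 2) (brk G (brk G e e) x)" by simp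
    then show "outer (outer x) = scl reduct (1 / 2) (brk reduct (brk G e e) x)"
      using x by (simp add: outer_def brk_proj form_es_brk proj_scale)
  next
    have "brk G (brk G e e) e = - brk G e (brk G e e)"
      using brk_skew[OF brk_e_e_hom e] by simp
    then have "scl G 3 (brk G e (brk G e e)) = 0"
      using leibniz[OF e e e_in] d by (simp add: scale_3 eq_diff_eq add_eq_0_iff)
    then show "outer (brk G e e) = 0" by (simp add: outer_def proj_zero)
  qed
  moreover have "1 / 2 * \<omega> (brk G e e) x = \<omega> e (brk G e x)" if "x \<in> sspace reduct" for x
  proof -
    have "2 * \<omega> e (brk G e x) = \<omega> (brk G e e) x"
      using form_brk[OF e e, of x] that d by (simp add: algebra_simps)
    then show ?thesis by (simp add: field_simps)
  qed
  then have "symplectic_iso (gen_double_ext reduct \<omega> outer (brk G e e)) (ext_form \<omega>) G \<omega> embed"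
    unfolding gen_double_ext_def d[symmetric] by (rule symplectic_iso_embed)
  ultimately show ?thesis
    unfolding is_gen_double_ext_of_def using odd_symplectic odd_symplectic_reduct by blast
qed

end

section \<open>Central elements of nilpotent algebras\<close>

context odd_symplectic_superalgebra
begin

lemma lower_central_subset: "lower_central G n \<subseteq> sspace G"
proof (induction n)
  case (Suc n)
  then show ?case
    unfolding lower_central.simps by (intro V.span_minimal subspace_sspace) auto
qed simp

text \<open>The last non-zero term of the lower central series is central. The homogeneous components of
  a central element are central, as their brackets with a homogeneous element lie in different
  degrees.\<close>

lemma ex_homogeneous_central:
  assumes "nilpotent G" "sspace G \<noteq> {0}"
  obtains c z where "z \<in> hom G c" "z \<noteq> 0" "\<And>x. x \<in> sspace G \<Longrightarrow> brk G x z = 0"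
proof -
  define n where "n = (LEAST n. lower_central G n = {0})"
  have n: "lower_central G n = {0}"
    using assms(1) unfolding nilpotent_def n_def by (rule LeastI_ex)
  then obtain m where m: "n = Suc m" using assms(2) by (cases n) auto
  then have "lower_central G m \<noteq> {0}"
    using not_less_Least[of m "\<lambda>n. lower_central G n = {0}"] unfolding n_def by simp
  moreover have "0 \<in> lower_central G m" by (cases m) (simp_all add: V.span_zero)
  ultimately obtain z where z: "z \<in> lower_central G m" "z \<noteq> 0" by blast
  then have zG: "z \<in> sspace G" using lower_central_subset by blast
  have cz: "brk G x z = 0" if "x \<in> sspace G" for x
  proof -
    have "brk G x z \<in> lower_central G n"
      unfolding m lower_central.simps using that z by (intro V.span_base) blast
    then show ?thesis using n by simp
  qed
  from zG obtain u v where uv: "u \<in> hom G 0" "v \<in> hom G 1" "z = u + v" by (rule sspace_cases)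
  note [simp] = hom_subset[OF uv(1)] hom_subset[OF uv(2)]
  have "brk G x u = 0 \<and> brk G x v = 0" if "x \<in> sspace G" for x
    using that
  proof (induction x rule: sspace_induct)
    case (hom a x)
    have "brk G x u = - brk G x v"
      using cz[OF hom_subset[OF hom]] uv hom_subset[OF hom] by (simp add: bilin eq_neg_iff_add_eq_0)
    then have "brk G x u \<in> hom G (a + 1)"
      using brk_hom[OF hom uv(2)] hom_closed(5) by simp
    then have "brk G x u = 0" using brk_hom[OF hom uv(1)] hom_eq_zero by simp
    then show ?case using \<open>brk G x u = - brk G x v\<close> by simp
  qed (simp add: bilin)
  moreover have "u \<noteq> 0 \<or> v \<noteq> 0" using uv(3) z(2) by auto
  ultimately show ?thesis using that uv by blast
qed

lemma ex_central_pair: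
  assumes "nilpotent G" "sspace G \<noteq> {0}"
  obtains d es e where "central_pair G \<omega> d es e"
proof -
  obtain c z where z: "z \<in> hom G c" "z \<noteq> 0" "\<And>x. x \<in> sspace G \<Longrightarrow> brk G x z = 0"
    using ex_homogeneous_central[OF assms] by blast
  have zG: "z \<in> sspace G" using z(1) by (rule hom_subset)
  obtain y where y: "y \<in> sspace G" "\<omega> z y \<noteq> 0" using form_nondegenerate[OF zG] z(2) by blast
  from y(1) obtain u v where uv: "u \<in> hom G 0" "v \<in> hom G 1" "y = u + v" by (rule sspace_cases)
  have "\<exists>x. x \<in> hom G (c + 1) \<and> \<omega> z x \<noteq> 0"
  proof (cases "c = 0")
    case True
    then have "\<omega> z u = 0" using form_odd z(1) uv(1) by blast
    then show ?thesis using uv y zG True by (intro exI[of _ v]) (simp add: bilin hom_subset)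
  next
    case False
    then have c: "c = 1" by simp
    then have "\<omega> z v = 0" using form_odd z(1) uv(2) by blast
    then show ?thesis using uv y zG c by (intro exI[of _ u]) (simp add: bilin hom_subset)
  qed
  then obtain x where x: "x \<in> hom G (c + 1)" "\<omega> z x \<noteq> 0" by blast
  have "central_pair G \<omega> (c + 1) z (scl G (1 / \<omega> z x) x)"
  proof unfold_locales
    show "scl G (1 / \<omega> z x) x \<in> hom G (c + 1)" using x hom_closed by blast
    show "\<omega> z (scl G (1 / \<omega> z x) x) = 1" using x zG hom_subset by (auto simp: bilin)
    show "z \<in> hom G (c + 1 + 1)" using z(1) by (simp only: bit_add_self)
  qed (rule z(3))
  then show ?thesis by (rule that)
qed

end

section \<open>Building nilpotent odd-symplectic superalgebras from zero\<close>

text \<open>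
  The space \<open>sspace G\<close> is finite-dimensional, but the ambient type need not be, so the size of a
  finite spanning set takes the place of the dimension as induction measure.
\<close>

lemma nilpotent_obtained_from_zero:
  fixes G :: "('k::field_char_0, 'v::ab_group_add) superalg"
  assumes "finite B" "module.span (scl G) B = sspace G" "odd_symplectic G \<omega>" "nilpotent G"
  shows "obtained_from_zero G \<omega>"
  using assms
proof (induction "card B" arbitrary: B G rule: less_induct)
  case less
  interpret odd_symplectic_superalgebra G \<omega> by unfold_locales (rule less.prems(3))
  show ?case
  proof (cases "sspace G = {0}")
    case True
    then show ?thesis by (intro obtained_from_zero.zero less.prems(3))
  next
    case False
    obtain d es e where "central_pair G \<omega> d es e"
      using ex_central_pair[OF less.prems(4) False] by blast
    then interpret central_pair G \<omega> d es e .
    obtain B' where B': "finite B'" "module.span (scl G) B' = sspace reduct" "card B' < card B"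
      using basis_reduct[OF less.prems(1,2)] .
    have H: "obtained_from_zero reduct \<omega>"
      using less.hyps[of B' reduct] B' odd_symplectic_reduct nilpotent_reduct[OF less.prems(4)]
      by simp
    show ?thesis
    proof (cases "d = 0")
      case True
      then show ?thesis by (rule obtained_from_zero.double[OF H double_ext_of_reduct])
    next
      case False
      then have "d = 1" by simp
      then show ?thesis by (rule obtained_from_zero.gen_double[OF H gen_double_ext_of_reduct])
    qed
  qed
qed

theorem corollary3p5:
  fixes G :: "('k::{alg_closed_field, field_char_0}, 'v::ab_group_add) superalg"
    and \<omega> :: "'v \<Rightarrow> 'v \<Rightarrow> 'k"
  assumes "odd_symplectic G \<omega>"
    and "nilpotent G"
    and "sspace G \<noteq> {0}"
  shows "obtained_from_zero G \<omega>"
proof -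
  have "super_vector_space G"
    using assms(1) unfolding odd_symplectic_def lie_superalgebra_def by (elim conjE)
  then obtain B where "finite B" "module.span (scl G) B = sspace G"
    unfolding super_vector_space_def by blast
  then show ?thesis using nilpotent_obtained_from_zero assms(1,2) by blast
qed

end
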